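(* Let $\mathcal F$ be a feeble semifilter (in which case $\mathfrak b(\mathcal F)=\mathfrak b$), and let $S=\{f_\alpha:\alpha<\mathfrak b\}$ be a $\mathfrak b(\mathcal F)$-scale. Then $X=S\cup Q$, viewed as a subspace of $\overline{\mathbb N}^{\uparrow\mathbb N}$, has the Hurewicz property.
   Context: $\mathbb N=\{0,1,2,\dots\}$, discrete; $\mathbb N^{\mathbb N}$ has the product topology. $[\mathbb N]^{\aleph_0}$ is the family of infinite subsets of $\mathbb N$; $A\subseteq^*B$ means $A\setminus B$ is finite. A semifilter is a nonempty $\mathcal F\subseteq[\mathbb N]^{\aleph_0}$ such that $A\in\mathcal F$, $B\subseteq\mathbb N$ and $A\subseteq^*B$ imply $B\in\mathcal F$. For $f,g\in\mathbb N^{\mathbb N}$, $f\le_{\mathcal F}g$ means $\{n:f(n)\le g(n)\}\in\mathcal F$, and $f\le^*g$ means $f(n)\le g(n)$ for all but finitely many $n$. A set $Y\subseteq\mathbb N^{\mathbb N}$ is bounded with respect to such a relation $R$ if there is $g\in\mathbb N^{\mathbb N}$ with $f\,R\,g$ for all $f\in Y$; otherwise it is unbounded. $\mathfrak b(\mathcal F)$ (respectively $\mathfrak b$) is the minimal cardinality of a subset of $\mathbb N^{\mathbb N}$ that is unbounded with respect to $\le_{\mathcal F}$ (respectively $\le^*$). A space has the Hurewicz property if each of its continuous images in $\mathbb N^{\mathbb N}$ is bounded with respect to $\le^*$. $\mathbb N^{\uparrow\mathbb N}$ is the set of (strictly) increasing elements of $\mathbb N^{\mathbb N}$. A family $\mathcal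 F\subseteq[\mathbb N]^{\aleph_0}$ is feeble if there is $h\in\mathbb N^{\uparrow\mathbb N}$ such that for each $A\in\mathcal F$, $A\cap[h(n),h(n+1))\ne\emptyset$ for all but finitely many $n$. A $\mathfrak b(\mathcal F)$-scale is a family $S=\{f_\alpha:\alpha<\mathfrak b(\mathcal F)\}\subseteq\mathbb N^{\uparrow\mathbb N}$ that is unbounded with respect to $\le_{\mathcal F}$ and satisfies $f_\alpha\le_{\mathcal F}f_\beta$ for all $\alpha<\beta<\mathfrak b(\mathcal F)$. $\overline{\mathbb N}=\mathbb N\cup\{\infty\}$ is the one-point compactification of $\mathbb N$. $\overline{\mathbb N}^{\uparrow\mathbb N}$ is the subspace of the product $\overline{\mathbb N}^{\mathbb N}$ consisting of the nondecreasing $f$ such that $f(n)<f(n+1)$ whenever $f(n)<\infty$. $Q$ is the (countable) set of all $f\in\overline{\mathbb N}^{\uparrow\mathbb N}$ that take the value $\infty$; thus $\overline{\mathbb N}^{\uparrow\mathbb N}=Q\cup\mathbb N^{\uparrow\mathbb N}$. *)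

theory Defs
  imports "HOL-Analysis.Analysis" "HOL-Library.Extended_Real"
begin

unbundle cardinal_syntax

definition almost_subset :: "nat set \<Rightarrow> nat set \<Rightarrow> bool"  (infix "\<subseteq>\<^sup>*" 50) where
  "A \<subseteq>\<^sup>* B \<longleftrightarrow> finite (A - B)"

definition semifilter :: "nat set set \<Rightarrow> bool" where
  "semifilter F \<longleftrightarrow> F \<noteq> {} \<and> F \<subseteq> {A. infinite A} \<and> (\<forall>A B. A \<in> F \<longrightarrow> A \<subseteq>\<^sup>* B \<longrightarrow> B \<in> F)"

definition feeble :: "nat set set \<Rightarrow> bool" where
  "feeble F \<longleftrightarrow>
     (\<exists>h::nat \<Rightarrow> nat. strict_mono h \<and>
        (\<forall>A\<in>F. \<forall>\<^sub>\<infinity>n. A \<inter> {h n..<h (Suc n)} \<noteq> {}))"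

definition le_mod :: "nat set set \<Rightarrow> (nat \<Rightarrow> nat) \<Rightarrow> (nat \<Rightarrow> nat) \<Rightarrow> bool" where
  "le_mod F f g \<longleftrightarrow> {n. f n \<le> g n} \<in> F"

definition le_star :: "(nat \<Rightarrow> nat) \<Rightarrow> (nat \<Rightarrow> nat) \<Rightarrow> bool" where
  "le_star f g \<longleftrightarrow> (\<forall>\<^sub>\<infinity>n. f n \<le> g n)"

definition bounded_wrt :: "((nat \<Rightarrow> nat) \<Rightarrow> (nat \<Rightarrow> nat) \<Rightarrow> bool) \<Rightarrow> (nat \<Rightarrow> nat) set \<Rightarrow> bool" where
  "bounded_wrt R Y \<longleftrightarrow> (\<exists>g. \<forall>f\<in>Y. R f g)"

text \<open>
  Cardinals are represented, as in the library, by well-orders that are minimal for their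
  cardinality. The least cardinality of an unbounded set is thus the relation
  \<open>|Y|\<close> for some unbounded \<open>Y\<close> of least cardinality; it is determined up to the
  order isomorphism \<open>=o\<close>. It is meaningful only if some set is unbounded
  with respect to \<open>R\<close>, which holds for both relations considered here.
\<close>

definition bounding_number ::
    "((nat \<Rightarrow> nat) \<Rightarrow> (nat \<Rightarrow> nat) \<Rightarrow> bool) \<Rightarrow> (nat \<Rightarrow> nat) rel" where
  "bounding_number R =
     (SOME r. \<exists>Y. \<not> bounded_wrt R Y \<and> r = |Y| \<and>
                (\<forall>Z. \<not> bounded_wrt R Z \<longrightarrow> |Y| \<le>o |Z| ))"

abbreviation \<bb> :: "(nat \<Rightarrow> nat) rel" where
  "\<bb> \<equiv> bounding_number le_star"

abbreviation \<bb>_mod :: "nat set set \<Rightarrow> (nat \<Rightarrow> nat) rel" where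
  "\<bb>_mod F \<equiv> bounding_number (le_mod F)"

lemma bounding_number_witness:
  assumes "\<not> bounded_wrt R Y0"
  shows "\<exists>Y. \<not> bounded_wrt R Y \<and> bounding_number R = |Y| \<and>
             (\<forall>Z. \<not> bounded_wrt R Z \<longrightarrow> |Y| \<le>o |Z| )"
proof -
  let ?C = "{ |Y| | Y. \<not> bounded_wrt R Y}"
  have "?C \<noteq> {}" "\<forall>r\<in>?C. Card_order r"
    using assms card_of_Card_order by auto
  from exists_minim_Card_order[OF this]
  have "\<exists>r Y. \<not> bounded_wrt R Y \<and> r = |Y| \<and> (\<forall>Z. \<not> bounded_wrt R Z \<longrightarrow> |Y| \<le>o |Z| )"
    by blast
  then show ?thesis
    unfolding bounding_number_def by (rule someI_ex)
qed

lemma unbounded_le_star_UNIV: "\<not> bounded_wrt le_star UNIV"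
proof
  assume "bounded_wrt le_star UNIV"
  then obtain g where "\<forall>f. le_star f g"
    by (auto simp: bounded_wrt_def)
  then have "le_star (\<lambda>n. Suc (g n)) g" by blast
  then show False by (simp add: le_star_def)
qed

lemma unbounded_le_mod_UNIV:
  assumes "semifilter F"
  shows "\<not> bounded_wrt (le_mod F) UNIV"
proof
  assume "bounded_wrt (le_mod F) UNIV"
  then obtain g where "\<forall>f. le_mod F f g"
    by (auto simp: bounded_wrt_def)
  then have "le_mod F (\<lambda>n. Suc (g n)) g" by blast
  then have "{} \<in> F" by (simp add: le_mod_def)
  with assms show False by (auto simp: semifilter_def)
qed

text \<open>
  The ordinals below \<open>\<bb>_mod F\<close> are the elements of its field, ordered by the relation
  \<open>\<bb>_mod F\<close> itself, which is the reflexive version of the order.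
\<close>

definition b_scale :: "nat set set \<Rightarrow> ((nat \<Rightarrow> nat) \<Rightarrow> nat \<Rightarrow> nat) \<Rightarrow> bool" where
  "b_scale F f \<longleftrightarrow>
     (\<forall>\<alpha>\<in>Field (\<bb>_mod F). strict_mono (f \<alpha>)) \<and>
     \<not> bounded_wrt (le_mod F) (f ` Field (\<bb>_mod F)) \<and>
     (\<forall>\<alpha> \<beta>. (\<alpha>, \<beta>) \<in> \<bb>_mod F \<longrightarrow> \<alpha> \<noteq> \<beta> \<longrightarrow> le_mod F (f \<alpha>) (f \<beta>))"

text \<open>
  The topology of type \<^typ>\<open>nat\<close> is discrete and that of a function type is the product
  topology.
\<close>

definition Hurewicz_space :: "'a topology \<Rightarrow> bool" where
  "Hurewicz_space X \<longleftrightarrow>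
     (\<forall>\<phi>. continuous_map X (euclidean :: (nat \<Rightarrow> nat) topology) \<phi> \<longrightarrow>
          bounded_wrt le_star (\<phi> ` topspace X))"

text \<open>
  Type \<^typ>\<open>enat\<close> with its order topology is the one-point compactification of the discrete
  space of natural numbers.
\<close>

lemma enat_one_point_compactification:
  "homeomorphic_map (Alexandroff_compactification (discrete_topology (UNIV :: nat set)))
     (euclidean :: enat topology) (case_option \<infinity> enat)"
  (is "homeomorphic_map ?X _ ?c")
proof (rule bijective_open_imp_homeomorphic_map)
  have cinj: "inj ?c"
    by (auto simp: inj_def split: option.splits)
  have csurj: "surj ?c"
  proof (rule surjI)
    show "?c (case y of enat n \<Rightarrow> Some n | \<infinity> \<Rightarrow> None) = y" for y
      by (cases y) auto
  qed
  have top: "topspace ?X = UNIV"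
    by (simp add: UNIV_option_conv)
  have fin: "finite C \<longleftrightarrow> (\<exists>n. C \<subseteq> {..n})" for C :: "nat set"
    using finite_nat_iff_bounded_le by blast
  have iff: "openin ?X U \<longleftrightarrow> open (?c ` U)" for U
  proof (cases "None \<in> U")
    case False
    then have "\<infinity> \<notin> ?c ` U" by (auto split: option.splits)
    moreover have "U = Some ` {n. Some n \<in> U}"
      using False by (auto simp: image_iff) (metis not_None_eq)
    ultimately show ?thesis
      by (subst open_enat_iff) (auto simp: openin_Alexandroff_compactification)
  next
    case True
    define C where "C = {n. Some n \<notin> U}"
    have U: "U = insert None (Some ` (UNIV - C))"
    proof (rule set_eqI)
      show "x \<in> U \<longleftrightarrow> x \<in> insert None (Some ` (UNIV - C))" for x
        using True by (cases x) (auto simp: C_def)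
    qed
    have C_unique: "D = C" if "U = insert None (Some ` (UNIV - D))" for D
      using that by (auto simp: C_def)
    have "openin ?X U \<longleftrightarrow> finite C"
    proof
      assume "openin ?X U"
      then obtain D where "finite D" "U = insert None (Some ` (UNIV - D))"
        using True by (auto simp: openin_Alexandroff_compactification compactin_discrete_topology)
      with C_unique show "finite C" by blast
    next
      assume "finite C"
      with U show "openin ?X U"
        by (simp only: openin_Alexandroff_compactification compactin_discrete_topology
              closedin_discrete_topology topspace_discrete_topology) blast
    qed
    also have "\<dots> \<longleftrightarrow> (\<exists>n. {enat n<..} \<subseteq> ?c ` U)"
    proof -
      have "{enat n<..} \<subseteq> ?c ` U \<longleftrightarrow> C \<subseteq> {..n}" for n
      proof -
        have mem: "enat m \<in> ?c ` U \<longleftrightarrow> m \<notin> C" "\<infinity> \<in> ?c ` U" for m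
        proof -
          have "enat m = ?c x \<longleftrightarrow> x = Some m" for x
            by (cases x) auto
          then show "enat m \<in> ?c ` U \<longleftrightarrow> m \<notin> C"
            by (simp add: C_def image_iff)
          show "\<infinity> \<in> ?c ` U"
            using True by (rule rev_image_eqI) simp
        qed
        show ?thesis
        proof
          assume L: "{enat n<..} \<subseteq> ?c ` U"
          show "C \<subseteq> {..n}"
          proof
            fix m assume "m \<in> C"
            then have "enat m \<notin> {enat n<..}" using L mem(1) by blast
            then show "m \<in> {..n}" by simp
          qed
        next
          assume R: "C \<subseteq> {..n}"
          show "{enat n<..} \<subseteq> ?c ` U"
          proof
            fix x assume "x \<in> {enat n<..}"
            then show "x \<in> ?c ` U"
              using R mem by (cases x) fastforce+
          qed
        qed
      qed
      then show ?thesis by (simp add: fin)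
    qed
    also have "\<dots> \<longleftrightarrow> open (?c ` U)"
      using True by (subst open_enat_iff) (auto simp: image_iff intro!: bexI[of _ None])
    finally show ?thesis .
  qed
  show "continuous_map ?X euclidean ?c"
    unfolding continuous_map_def top
  proof (intro conjI allI impI)
    show "?c \<in> UNIV \<rightarrow> topspace euclidean" by simp
    fix V :: "enat set" assume "openin euclidean V"
    moreover have "?c ` {x \<in> UNIV. ?c x \<in> V} = V"
      using surj_image_vimage_eq[OF csurj, of V] by (simp add: vimage_def)
    ultimately show "openin ?X {x \<in> UNIV. ?c x \<in> V}"
      by (simp add: iff del: UNIV_I)
  qed
  show "open_map ?X euclidean ?c"
    by (auto simp: open_map_def iff)
  show "?c ` topspace ?X = topspace euclidean"
    using csurj top by simp
  show "inj_on ?c (topspace ?X)"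
    using cinj top by simp
qed

definition ext_increasing :: "(nat \<Rightarrow> enat) set" where
  "ext_increasing = {f. mono f \<and> (\<forall>n. f n < \<infinity> \<longrightarrow> f n < f (Suc n))}"

definition Q :: "(nat \<Rightarrow> enat) set" where
  "Q = {f \<in> ext_increasing. \<exists>n. f n = \<infinity>}"

text \<open>The inclusion of the increasing functions into \<^const>\<open>ext_increasing\<close>.\<close>

definition embed_seq :: "(nat \<Rightarrow> nat) \<Rightarrow> nat \<Rightarrow> enat" where
  "embed_seq f = (\<lambda>n. enat (f n))"

lemma ext_increasing_eq: "ext_increasing = Q \<union> embed_seq ` {f. strict_mono f}"
proof (intro equalityI subsetI)
  fix f assume f: "f \<in> ext_increasing"
  show "f \<in> Q \<union> embed_seq ` {f. strict_mono f}"
  proof (cases "\<exists>n. f n = \<infinity>")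
    case True
    with f show ?thesis by (simp add: Q_def)
  next
    case False
    then have fin: "f n = enat (the_enat (f n))" for n
      using False by (metis enat.exhaust the_enat.simps infinity_enat_def)
    have "enat (the_enat (f n)) < enat (the_enat (f (Suc n)))" for n
      using f fin[symmetric] False by (simp add: ext_increasing_def)
    then have "strict_mono (\<lambda>n. the_enat (f n))"
      by (simp add: strict_mono_Suc_iff)
    moreover have "f = embed_seq (\<lambda>n. the_enat (f n))"
      unfolding embed_seq_def by (rule ext) (rule fin)
    ultimately show ?thesis by blast
  qed
next
  fix f assume "f \<in> Q \<union> embed_seq ` {f. strict_mono f}"
  then show "f \<in> ext_increasing"
    by (auto simp: Q_def ext_increasing_def embed_seq_def strict_mono_Suc_iff mono_iff_le_Suc
          less_imp_le)
qed

end

theory Submission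
  imports Defs
begin

text \<open>
  Let \<open>h\<close> witness feebleness. For monotone functions, \<open>f \<le>\<^sub>F g\<close> gives
  \<open>f (h k) \<le> g (h (k + 1))\<close> for almost all \<open>k\<close>, since the two are compared at some point of
  almost every block. This turns \<open>\<le>\<^sub>F\<close>-bounds into \<open>\<le>\<^sup>*\<close>-bounds, hence the equality of
  the bounding numbers. A continuous map \<open>\<phi>\<close> on \<open>S \<union> Q\<close> admits \<open>g\<close> such that
  \<open>g n < x n\<close> implies \<open>\<phi> x i \<le> g n\<close> for all \<open>i \<le> n\<close>, because \<open>{x. x n = \<infinity>}\<close> is
  compact and contained in \<open>Q\<close>. Some \<open>f\<^sub>\<alpha>\<close> exceeds \<open>n \<mapsto> g (h (n + 1))\<close> on an
  infinite set \<open>I\<close>, and then every later \<open>f\<^sub>\<beta>\<close> satisfies \<open>f\<^sub>\<beta> (h (n + 1)) > g (h (n + 1))\<close> for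
  almost all \<open>n \<in> I\<close>, with \<open>I\<close> not depending on \<open>\<beta>\<close>. This bounds the images of all later
  \<open>f\<^sub>\<beta>\<close> and of \<open>Q\<close> at once; the remaining \<open>f\<^sub>\<beta>\<close> are fewer than \<open>\<bb>\<close> many.
\<close>

section \<open>Compactness and continuous maps near \<open>Q\<close>\<close>

text \<open>Since \<infinity> + 1 = \<infinity> in \<open>enat\<close>, the inequalities
  \<open>f n + 1 \<le> f (Suc n)\<close> express both monotonicity and strictness at finite values,
  and their two sides are continuous in \<open>f\<close>.\<close>

lemma closed_ext_increasing: "closed ext_increasing"
proof -
  have "ext_increasing = {f. \<forall>n. f n + 1 \<le> f (Suc n)}"
  proof (intro set_eqI iffI)
    fix f assume "f \<in> ext_increasing"
    then have "f n \<le> f (Suc n)" "f n < \<infinity> \<Longrightarrow> f n < f (Suc n)" for n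
      by (auto simp: ext_increasing_def mono_iff_le_Suc)
    then have "eSuc (f n) \<le> f (Suc n)" for n
      by (metis eSuc_infinity enat_ord_simps(4) ileI1)
    then have "f n + 1 \<le> f (Suc n)" for n
      by (simp add: eSuc_plus_1)
    then show "f \<in> {f. \<forall>n. f n + 1 \<le> f (Suc n)}" by simp
  next
    fix f :: "nat \<Rightarrow> enat" assume "f \<in> {f. \<forall>n. f n + 1 \<le> f (Suc n)}"
    then have le: "eSuc (f n) \<le> f (Suc n)" for n by (simp add: eSuc_plus_1)
    have "f n \<le> f (Suc n)" for n
      using le[of n] by (meson ile_eSuc order_trans)
    moreover have "f n < \<infinity> \<longrightarrow> f n < f (Suc n)" for n
      using le[of n] by (cases "f n") (auto simp: eSuc_enat Suc_ile_eq)
    ultimately show "f \<in> ext_increasing"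
      by (simp add: ext_increasing_def mono_iff_le_Suc)
  qed
  moreover have "closed {f :: nat \<Rightarrow> enat. \<forall>n. f n + 1 \<le> f (Suc n)}"
    by (intro closed_Collect_all closed_Collect_le continuous_on_add continuous_on_const
        continuous_on_product_coordinates)
  ultimately show ?thesis by (simp only:)
qed

lemma compact_ext_increasing: "compact ext_increasing"
proof -
  have "compact_space (euclidean :: (nat \<Rightarrow> enat) topology)"
    unfolding euclidean_product_topology[symmetric] compact_space_product_topology
    using compact_UNIV[where 'a = enat] by (simp add: compact_space_def)
  then have "compact (UNIV :: (nat \<Rightarrow> enat) set)"
    by (simp add: compact_space_def)
  with closed_ext_increasing show ?thesis
    using closed_Int_compact by fastforce
qed

text \<open>Counterexamples \<open>x b\<close> for all \<open>b\<close> would have a cluster point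
  \<open>y\<close> by compactness. As \<open>x b n\<close> exceeds \<open>b\<close>,
  \<open>y n\<close> is infinite, so \<open>y\<close> lies in \<open>Q\<close> and hence in
  \<open>X\<close>; but near \<open>y\<close> the map \<psi> is constant, while its values at
  \<open>x b\<close> exceed \<open>b\<close>.\<close>

lemma continuous_bounded_near_Q:
  fixes \<psi> :: "(nat \<Rightarrow> enat) \<Rightarrow> nat"
  assumes X: "X \<subseteq> ext_increasing" "Q \<subseteq> X" and cont: "continuous_on X \<psi>"
  shows "\<exists>b. \<forall>x\<in>X. enat b < x n \<longrightarrow> \<psi> x \<le> b"
proof (rule ccontr)
  assume "\<not> ?thesis"
  then have "\<forall>b. \<exists>x\<in>X. enat b < x n \<and> b < \<psi> x"
    by (meson not_le)
  then obtain x where x: "\<And>b. x b \<in> X" "\<And>b. enat b < x b n" "\<And>b. b < \<psi> (x b)"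
    by metis
  let ?F = "filtermap x sequentially"
  have "eventually (\<lambda>z. z \<in> ext_increasing) ?F" "?F \<noteq> bot"
    using subsetD[OF X(1) x(1)]
    by (auto simp: eventually_filtermap filtermap_bot_iff)
  then obtain y where y: "y \<in> ext_increasing" "inf (nhds y) ?F \<noteq> bot"
    using compact_ext_increasing[unfolded compact_filter, rule_format, of ?F] by blast
  \<comment> \<open>A neighbourhood of a cluster point contains \<open>x b\<close> for arbitrarily
    large \<open>b\<close>.\<close>
  have clash: False
    if "open U" "y \<in> U" "\<And>b. k \<le> b \<Longrightarrow> x b \<notin> U" for U k
  proof -
    have "eventually (\<lambda>z. z \<in> U) (nhds y)"
      using that(1,2) by (rule eventually_nhds_in_open)
    moreover have "eventually (\<lambda>z. z \<notin> U) ?F"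
      unfolding eventually_filtermap eventually_sequentially using that(3) by blast
    ultimately have "eventually (\<lambda>z. False) (inf (nhds y) ?F)"
      unfolding eventually_inf by blast
    with y(2) show False
      by (simp only: eventually_False)
  qed
  have "y n = \<infinity>"
  proof (rule ccontr)
    assume "y n \<noteq> \<infinity>"
    then obtain k where k: "y n = enat k" by auto
    have "continuous_on UNIV (\<lambda>z :: nat \<Rightarrow> enat. z n)"
      by (rule continuous_on_product_coordinates)
    then have "open ((\<lambda>z. z n) -` {enat k})"
      using open_vimage[OF open_enat] by blast
    moreover have "x b n \<noteq> enat k" if "k \<le> b" for b
      using x(2)[of b] that by auto
    ultimately show False
      using clash[of "(\<lambda>z. z n) -` {enat k}" k] k by auto
  qed
  with y X have "y \<in> X" by (auto simp: Q_def)
  \<comment> \<open>Points of \<open>nat\<close> are open, so the fibre of \<psi> through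
    \<open>y\<close> is relatively open in \<open>X\<close>.\<close>
  obtain U where U: "open U" "U \<inter> X = \<psi> -` {\<psi> y} \<inter> X"
    using cont by (metis continuous_on_open_invariant open_discrete)
  moreover have "x b \<notin> U" if "\<psi> y \<le> b" for b
  proof -
    have "\<psi> (x b) \<noteq> \<psi> y" using x(3)[of b] that by simp
    then show ?thesis using x(1)[of b] U(2) by blast
  qed
  ultimately show False
    using clash[of U "\<psi> y"] \<open>y \<in> X\<close> by blast
qed

section \<open>Feebleness and the bounding numbers\<close>

lemma bounding_number_card_of:
  assumes "\<not> bounded_wrt R Z"
  shows "Card_order (bounding_number R)" "bounding_number R \<le>o |Z|"
  using bounding_number_witness[OF assms] assms card_of_Card_order by metis+

lemma bounding_number_le:
  assumes "\<not> bounded_wrt R Z"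
    and "\<And>Y. \<not> bounded_wrt R Y \<Longrightarrow> \<exists>Y'. \<not> bounded_wrt R' Y' \<and> |Y'| \<le>o |Y|"
  shows "bounding_number R' \<le>o bounding_number R"
proof -
  obtain Y where "\<not> bounded_wrt R Y" "bounding_number R = |Y|"
    using bounding_number_witness[OF assms(1)] by blast
  then show ?thesis
    using assms(2) bounding_number_card_of(2) ordLeq_transitive by metis
qed

lemma le_star_imp_le_mod:
  assumes "semifilter F" "le_star f g"
  shows "le_mod F f g"
proof -
  obtain A where "A \<in> F" using assms(1) by (auto simp: semifilter_def)
  moreover have "A \<subseteq>\<^sup>* {n. f n \<le> g n}"
    using assms(2) finite_subset[of "A - {n. f n \<le> g n}" "{n. \<not> f n \<le> g n}"]
    by (auto simp: almost_subset_def le_star_def MOST_iff_cofinite)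
  ultimately show ?thesis
    using assms(1) by (auto simp: semifilter_def le_mod_def)
qed

lemma bounded_le_star_imp_le_mod:
  "semifilter F \<Longrightarrow> bounded_wrt le_star Y \<Longrightarrow> bounded_wrt (le_mod F) Y"
  unfolding bounded_wrt_def using le_star_imp_le_mod by blast

lemma le_mod_imp_le_blocks:
  fixes h :: "nat \<Rightarrow> nat"
  assumes "\<forall>A\<in>F. \<forall>\<^sub>\<infinity>n. A \<inter> {h n..<h (Suc n)} \<noteq> {}"
    and "le_mod F f g" "mono f" "mono g"
  shows "\<forall>\<^sub>\<infinity>n. f (h n) \<le> g (h (Suc n))"
proof -
  have "\<forall>\<^sub>\<infinity>n. {n. f n \<le> g n} \<inter> {h n..<h (Suc n)} \<noteq> {}"
    using assms(1,2) by (simp add: le_mod_def)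
  then show ?thesis
  proof (rule MOST_mono)
    fix n assume "{n. f n \<le> g n} \<inter> {h n..<h (Suc n)} \<noteq> {}"
    then obtain m where "f m \<le> g m" "h n \<le> m" "m < h (Suc n)" by auto
    then have m: "f m \<le> g m" "h n \<le> m" "m \<le> h (Suc n)" by simp_all
    have "f (h n) \<le> f m" using m assms(3) by (simp add: monoD)
    also have "\<dots> \<le> g m" by (fact m)
    also have "\<dots> \<le> g (h (Suc n))" using m assms(4) by (simp add: monoD)
    finally show "f (h n) \<le> g (h (Suc n))" .
  qed
qed

text \<open>The block comparison requires monotone functions; this is the least monotone function
  above \<open>f\<close>.\<close>

definition run_max :: "(nat \<Rightarrow> nat) \<Rightarrow> nat \<Rightarrow> nat" where
  "run_max f n = Max (f ` {..n})"

lemma run_max_ge: "i \<le> n \<Longrightarrow> f i \<le> run_max f n"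
  by (simp add: run_max_def)

lemma mono_run_max: "mono (run_max f)"
  by (auto simp: mono_def run_max_def intro!: Max_mono)

lemma bounded_le_mod_imp_le_star:
  assumes h: "strict_mono h" "\<forall>A\<in>F. \<forall>\<^sub>\<infinity>n. A \<inter> {h n..<h (Suc n)} \<noteq> {}"
    and F: "semifilter F"
    and Y: "bounded_wrt (le_mod F) (run_max ` Y)"
  shows "bounded_wrt le_star Y"
proof -
  obtain g where g: "\<And>f. f \<in> Y \<Longrightarrow> le_mod F (run_max f) g"
    using Y by (auto simp: bounded_wrt_def)
  have "le_star f (\<lambda>n. run_max g (h (Suc n)))" if "f \<in> Y" for f
  proof -
    have "{n. run_max f n \<le> g n} \<subseteq> {n. run_max f n \<le> run_max g n}"
      using run_max_ge[of _ _ g] by (auto intro: order_trans)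
    then have "{n. run_max f n \<le> g n} \<subseteq>\<^sup>* {n. run_max f n \<le> run_max g n}"
      by (simp add: almost_subset_def Diff_eq_empty_iff[THEN iffD2])
    then have "le_mod F (run_max f) (run_max g)"
      using g[OF that] F by (auto simp: le_mod_def semifilter_def)
    from le_mod_imp_le_blocks[OF h(2) this mono_run_max mono_run_max]
    \<comment> \<open>Here \<open>n \<le> h n\<close> gives
      \<open>f n \<le> run_max f (h n)\<close>.\<close>
    show ?thesis
      unfolding le_star_def
      by (rule MOST_mono) (meson h(1) order_trans run_max_ge strict_mono_imp_increasing)
  qed
  then show ?thesis by (auto simp: bounded_wrt_def)
qed

lemma bounding_number_feeble:
  assumes F: "semifilter F" "feeble F"
  shows "\<bb>_mod F =o \<bb>"
proof -
  obtain h where h: "strict_mono h" "\<forall>A\<in>F. \<forall>\<^sub>\<infinity>n. A \<inter> {h n..<h (Suc n)} \<noteq> {}"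
    using F(2) by (auto simp: feeble_def)
  \<comment> \<open>The running maxima of a \<open>le_star\<close>-unbounded family form a
    \<open>le_mod F\<close>-unbounded family that is no larger.\<close>
  have "\<bb>_mod F \<le>o \<bb>"
    using bounded_le_mod_imp_le_star[OF h F(1)]
    by (intro bounding_number_le[OF unbounded_le_star_UNIV]) (metis card_of_image)
  moreover have "\<bb> \<le>o \<bb>_mod F"
    using bounded_le_star_imp_le_mod[OF F(1)]
    by (intro bounding_number_le[OF unbounded_le_mod_UNIV[OF F(1)]])
      (metis card_of_mono1 order_refl)
  ultimately show ?thesis by (simp add: ordIso_iff_ordLeq)
qed

section \<open>The Hurewicz property\<close>

lemma bounded_wrt_le_star_Un:
  assumes "bounded_wrt le_star Y" "bounded_wrt le_star Z"
  shows "bounded_wrt le_star (Y \<union> Z)"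
proof -
  obtain g k where "\<And>f. f \<in> Y \<Longrightarrow> le_star f g" "\<And>f. f \<in> Z \<Longrightarrow> le_star f k"
    using assms by (auto simp: bounded_wrt_def)
  then have "\<forall>f\<in>Y \<union> Z. le_star f (\<lambda>n. max (g n) (k n))"
    unfolding le_star_def MOST_nat_le le_max_iff_disj by blast
  then show ?thesis by (auto simp: bounded_wrt_def)
qed

text \<open>The bound at a place of \<open>I\<close> also controls all smaller coordinates, so
  coordinate \<open>n\<close> is bounded by \<open>g\<close> at the next place of \<open>I\<close>.
  That place does not depend on \<open>x\<close>.\<close>

lemma bounded_on_infinite_set:
  fixes \<phi> :: "'a \<Rightarrow> nat \<Rightarrow> nat"
  assumes g: "\<And>x n i. x \<in> X \<Longrightarrow> i \<le> n \<Longrightarrow> P x n \<Longrightarrow> \<phi> x i \<le> g n"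
    and I: "infinite I" and ev: "\<And>x. x \<in> X \<Longrightarrow> \<forall>\<^sub>\<infinity>n. n \<in> I \<longrightarrow> P x n"
  shows "bounded_wrt le_star (\<phi> ` X)"
proof -
  define next_I where "next_I n = (LEAST m. m \<in> I \<and> n \<le> m)" for n
  have "\<exists>m. m \<in> I \<and> n \<le> m" for n
    using I by (metis infinite_nat_iff_unbounded_le)
  then have next_I: "next_I n \<in> I" "n \<le> next_I n" for n
    using LeastI_ex[of "\<lambda>m. m \<in> I \<and> n \<le> m"] unfolding next_I_def by auto
  have "le_star (\<phi> x) (\<lambda>n. g (next_I n))" if x: "x \<in> X" for x
  proof -
    obtain N where "\<And>n. N \<le> n \<Longrightarrow> n \<in> I \<Longrightarrow> P x n"
      using ev[OF x] by (auto simp: MOST_nat_le)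
    then have "\<phi> x n \<le> g (next_I n)" if "N \<le> n" for n
      using g[OF x next_I(2)] next_I that by (meson order_trans)
    then show ?thesis by (auto simp: le_star_def MOST_nat_le)
  qed
  then show ?thesis by (auto simp: bounded_wrt_def)
qed

lemma continuous_image_bounds:
  fixes \<phi> :: "(nat \<Rightarrow> enat) \<Rightarrow> nat \<Rightarrow> nat"
  assumes X: "X \<subseteq> ext_increasing" "Q \<subseteq> X" and cont: "continuous_on X \<phi>"
  obtains g :: "nat \<Rightarrow> nat"
  where "\<And>x n i. x \<in> X \<Longrightarrow> i \<le> n \<Longrightarrow> enat (g n) < x n \<Longrightarrow> \<phi> x i \<le> g n"
proof -
  have "continuous_on X (\<lambda>x. \<phi> x i)" for i
    using continuous_on_product_then_coordinatewise[OF cont] .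
  then have "\<exists>b. \<forall>x\<in>X. enat b < x n \<longrightarrow> \<phi> x i \<le> b" for i n
    by (rule continuous_bounded_near_Q[OF X])
  then have "\<forall>i n. \<exists>b. \<forall>x\<in>X. enat b < x n \<longrightarrow> \<phi> x i \<le> b"
    by blast
  then obtain b where b: "\<And>i n x. x \<in> X \<Longrightarrow> enat (b i n) < x n \<Longrightarrow> \<phi> x i \<le> b i n"
    by metis
  \<comment> \<open>Maximizing over \<open>i \<le> n\<close> lets one number serve as threshold for
    \<open>x n\<close> and as bound for all these coordinates.\<close>
  have "\<phi> x i \<le> run_max (\<lambda>i. b i n) n"
    if "x \<in> X" "i \<le> n" "enat (run_max (\<lambda>i. b i n) n) < x n" for x n i
  proof -
    have le: "b i n \<le> run_max (\<lambda>i. b i n) n"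
      using that(2) by (rule run_max_ge)
    then have "enat (b i n) < x n"
      using that(3) by (meson enat_ord_simps(1) le_less_trans)
    with b[OF that(1)] le show ?thesis by (meson order_trans)
  qed
  then show ?thesis by (rule that)
qed

lemma Hurewicz_scale:
  assumes F: "semifilter F" "feeble F" and f: "b_scale F f"
  defines "X \<equiv> embed_seq ` f ` Field (\<bb>_mod F) \<union> Q"
  assumes cont: "continuous_on X \<phi>"
  shows "bounded_wrt le_star (\<phi> ` X)"
proof -
  let ?r = "\<bb>_mod F"
  obtain h where h: "strict_mono h" "\<forall>A\<in>F. \<forall>\<^sub>\<infinity>n. A \<inter> {h n..<h (Suc n)} \<noteq> {}"
    using F(2) by (auto simp: feeble_def)
  have sm: "strict_mono (f \<alpha>)" if "\<alpha> \<in> Field ?r" for \<alpha>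
    using f that by (auto simp: b_scale_def)
  then have "X \<subseteq> ext_increasing" "Q \<subseteq> X"
    by (auto simp: X_def ext_increasing_eq)
  then obtain g where g: "\<And>x n i. x \<in> X \<Longrightarrow> i \<le> n \<Longrightarrow> enat (g n) < x n \<Longrightarrow> \<phi> x i \<le> g n"
    using continuous_image_bounds[OF _ _ cont] by metis
  have card: "Card_order ?r"
    using bounding_number_card_of(1) unbounded_le_mod_UNIV[OF F(1)] .

  have "\<not> bounded_wrt (le_mod F) (f ` Field ?r)"
    using f by (simp add: b_scale_def)
  then obtain \<alpha> where \<alpha>: "\<alpha> \<in> Field ?r" "\<not> le_mod F (f \<alpha>) (\<lambda>n. g (h (Suc n)))"
    by (auto simp: bounded_wrt_def)
  define I where "I = {n. g (h (Suc n)) < f \<alpha> n}"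
  have "infinite I"
    using le_star_imp_le_mod[OF F(1)] \<alpha>(2)
    by (auto simp: I_def le_star_def MOST_iff_cofinite not_le)
  \<comment> \<open>The comparison starts at \<open>n\<close> in \<open>I\<close> but reaches f
    \<beta> only at the end of the block, so the common infinite set consists of the points
    \<open>h (Suc n)\<close>.\<close>
  then have J: "infinite ((\<lambda>n. h (Suc n)) ` I)"
    using h(1) by (simp add: finite_image_iff inj_on_def strict_mono_eq)

  define late where "late = embed_seq ` f ` {\<beta> \<in> Field ?r. \<beta> \<notin> underS ?r \<alpha>} \<union> Q"
  have "\<forall>\<^sub>\<infinity>n. n \<in> (\<lambda>n. h (Suc n)) ` I \<longrightarrow> enat (g n) < x n" if "x \<in> late" for x
    using that unfolding late_def
  proof (elim UnE imageE)
    assume "x \<in> Q"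
    then obtain k where "x k = \<infinity>" "mono x" by (auto simp: Q_def ext_increasing_def)
    then have "x n = \<infinity>" if "k \<le> n" for n
      using that by (metis enat_ord_simps(5) monoD)
    then show ?thesis by (auto simp: MOST_nat_le intro!: exI[of _ k])
  next
    fix y \<beta> assume x: "x = embed_seq y" "y = f \<beta>" "\<beta> \<in> {\<beta> \<in> Field ?r. \<beta> \<notin> underS ?r \<alpha>}"
    have "total_on (Field ?r) ?r"
      using card_order_on_well_order_on[OF card]
      by (simp add: well_order_on_def linear_order_on_def)
    with \<alpha>(1) x(3) have "\<alpha> = \<beta> \<or> (\<alpha>, \<beta>) \<in> ?r"
      unfolding total_on_def underS_def by blast
    then have "\<alpha> = \<beta> \<or> le_mod F (f \<alpha>) (f \<beta>)"
      using f unfolding b_scale_def by blast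
    \<comment> \<open>The scale compares only distinct indices; for \<alpha> itself monotonicity
      suffices.\<close>
    then have le: "\<forall>\<^sub>\<infinity>n. f \<alpha> (h n) \<le> f \<beta> (h (Suc n))"
    proof
      assume "\<alpha> = \<beta>"
      then show ?thesis
        using strict_mono_less_eq[OF sm[OF \<alpha>(1)]] strict_mono_less_eq[OF h(1)] by simp
    next
      assume "le_mod F (f \<alpha>) (f \<beta>)"
      then show ?thesis
        using le_mod_imp_le_blocks[OF h(2)] sm \<alpha>(1) x(3) by (simp add: strict_mono_mono)
    qed
    obtain N where N: "f \<alpha> (h n) \<le> f \<beta> (h (Suc n))" if "N \<le> n" for n
      using le by (auto simp: MOST_nat_le)
    \<comment> \<open>Strict monotonicity of \<open>h\<close> turns the threshold
      \<open>h (Suc N)\<close> on points into \<open>N \<le> n\<close> on block indices.\<close>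
    have "g (h (Suc n)) < f \<beta> (h (Suc n))" if "n \<in> I" "h (Suc N) \<le> h (Suc n)" for n
    proof -
      have "g (h (Suc n)) < f \<alpha> n" using that(1) by (simp add: I_def)
      also have "\<dots> \<le> f \<alpha> (h n)"
        using strict_mono_less_eq[OF sm[OF \<alpha>(1)]] strict_mono_imp_increasing[OF h(1)] by simp
      also have "\<dots> \<le> f \<beta> (h (Suc n))"
        using N that(2) strict_mono_less_eq[OF h(1)] by simp
      finally show ?thesis .
    qed
    then show ?thesis
      by (auto simp: MOST_nat_le x embed_seq_def intro!: exI[of _ "h (Suc N)"])
  qed
  moreover have "late \<subseteq> X" by (auto simp: late_def X_def)
  ultimately have late: "bounded_wrt le_star (\<phi> ` late)"
    by (intro bounded_on_infinite_set[OF _ J, where P = "\<lambda>x n. enat (g n) < x n" and g = g])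
      (use g in blast)+

  \<comment> \<open>A proper initial segment of a cardinal has smaller cardinality, so this image
    has fewer than \<bb> elements and is bounded whatever \<phi> is.\<close>
  define early where "early = (\<lambda>\<beta>. \<phi> (embed_seq (f \<beta>))) ` underS ?r \<alpha>"
  have "|early| <o ?r"
    unfolding early_def
    by (rule ordLeq_ordLess_trans[OF card_of_image card_of_underS[OF card \<alpha>(1)]])
  then have "|early| <o \<bb>"
    using bounding_number_feeble[OF F] by (rule ordLess_ordIso_trans)
  then have "bounded_wrt le_star early"
    using bounding_number_card_of(2) not_ordLess_ordLeq by blast
  then have "bounded_wrt le_star (early \<union> \<phi> ` late)"
    using late by (rule bounded_wrt_le_star_Un)
  moreover have "\<phi> ` X \<subseteq> early \<union> \<phi> ` late"
    by (auto simp: X_def early_def late_def)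
  ultimately show ?thesis by (auto simp: bounded_wrt_def)
qed

theorem theorem2p28:
  fixes F :: "nat set set"
  assumes "semifilter F" and "feeble F"
  shows "\<bb>_mod F =o \<bb> \<and>
    (\<forall>f S. b_scale F f \<longrightarrow> S = f ` Field (\<bb>_mod F) \<longrightarrow>
       Hurewicz_space (subtopology (top_of_set ext_increasing) (embed_seq ` S \<union> Q)))"
proof (intro conjI allI impI)
  show "\<bb>_mod F =o \<bb>" using assms by (rule bounding_number_feeble)
next
  fix f S assume f: "b_scale F f" and S: "S = f ` Field (\<bb>_mod F)"
  let ?X = "embed_seq ` S \<union> Q"
  have "?X \<subseteq> ext_increasing"
    using f by (auto simp: S b_scale_def ext_increasing_eq)
  then have "subtopology (top_of_set ext_increasing) ?X = top_of_set ?X"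
    by (simp add: subtopology_subtopology Int_absorb1)
  then show "Hurewicz_space (subtopology (top_of_set ext_increasing) ?X)"
    using Hurewicz_scale[OF assms f] by (simp add: Hurewicz_space_def S)
qed

end
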